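(* Let $\omega$ be a positive integer and let $\epsilon>0$. If $\sigma>\frac{18}{\epsilon^2}$, then there is a strategy that forces any online coloring algorithm to use $(3-\epsilon)\omega-o(1)$ colors on a $\sigma$-interval graph of clique number at most $\omega$.
   Context: For $\sigma\ge 1$, a $\sigma$-interval graph is the intersection graph of a finite family of closed intervals on the real line, each of length in $[1,\sigma)$. An online coloring algorithm receives the vertices of a graph one at a time (it learns only the adjacencies to previously presented vertices, not any interval representation) and must irrevocably assign each vertex a color different from those of its already-presented neighbours, depending only on the subgraph induced by the vertices presented so far and the colors already assigned. A strategy is an adversary that adaptively chooses the next vertex (and its adjacencies) based on the algorithm's previous choices. *)

theory Defs
  imports Complex_Main "HOL-Library.Landau_Symbols"
begin

text \<open>A simple graph is given by a vertex set and an adjacency relation on it.\<close>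

definition is_clique :: "'a set \<Rightarrow> ('a \<Rightarrow> 'a \<Rightarrow> bool) \<Rightarrow> 'a set \<Rightarrow> bool" where
  "is_clique V E C \<longleftrightarrow> C \<subseteq> V \<and> (\<forall>u\<in>C. \<forall>v\<in>C. u \<noteq> v \<longrightarrow> E u v)"

text \<open>Only meaningful for finite \<open>V\<close>.\<close>

definition clique_number :: "'a set \<Rightarrow> ('a \<Rightarrow> 'a \<Rightarrow> bool) \<Rightarrow> nat" where
  "clique_number V E = Max (card ` {C. is_clique V E C})"

text \<open>Vertex \<open>v\<close> is represented by the closed interval from \<open>l v\<close> to \<open>r v\<close>; distinct vertices
  may be represented by the same interval.\<close>

definition sigma_interval_graph :: "real \<Rightarrow> 'a set \<Rightarrow> ('a \<Rightarrow> 'a \<Rightarrow> bool) \<Rightarrow> bool" where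
  "sigma_interval_graph \<sigma> V E \<longleftrightarrow> finite V \<and>
     (\<exists>l r :: 'a \<Rightarrow> real.
        (\<forall>v\<in>V. 1 \<le> r v - l v \<and> r v - l v < \<sigma>) \<and>
        (\<forall>u\<in>V. \<forall>v\<in>V. u \<noteq> v \<longrightarrow> (E u v \<longleftrightarrow> {l u..r u} \<inter> {l v..r v} \<noteq> {})))"

text \<open>A position of the game lists, in order of presentation, each vertex's set of neighbours among
  the earlier vertices together with the colour it received. Vertices are named by their index in
  the list, colours by natural numbers.\<close>

type_synonym position = "(nat set \<times> nat) list"

definition verts :: "position \<Rightarrow> nat set" where
  "verts p = {..<length p}"

definition adj :: "position \<Rightarrow> nat \<Rightarrow> nat \<Rightarrow> bool" where
  "adj p u v \<longleftrightarrow> u < length p \<and> v < length p \<and>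
     (u < v \<and> u \<in> fst (p ! v) \<or> v < u \<and> v \<in> fst (p ! u))"

definition colour :: "position \<Rightarrow> nat \<Rightarrow> nat" where
  "colour p v = snd (p ! v)"

text \<open>An algorithm sees the current position and the neighbours of the new vertex, and returns the
  colour of the new vertex.\<close>

type_synonym algorithm = "position \<Rightarrow> nat set \<Rightarrow> nat"

definition online_colouring_algorithm :: "algorithm \<Rightarrow> bool" where
  "online_colouring_algorithm A \<longleftrightarrow>
     (\<forall>p N. N \<subseteq> verts p \<longrightarrow> A p N \<notin> colour p ` N)"

text \<open>A strategy returns the neighbours of the next vertex, or \<open>None\<close> to stop presenting.\<close>

type_synonym strategy = "position \<Rightarrow> nat set option"

definition online_strategy :: "strategy \<Rightarrow> bool" where
  "online_strategy S \<longleftrightarrow> (\<forall>p N. S p = Some N \<longrightarrow> N \<subseteq> verts p)"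

text \<open>The position after \<open>n\<close> rounds; it no longer changes once the strategy has stopped.\<close>

primrec play :: "strategy \<Rightarrow> algorithm \<Rightarrow> nat \<Rightarrow> position" where
  "play S A 0 = []"
| "play S A (Suc n) =
     (case S (play S A n) of
        None \<Rightarrow> play S A n
      | Some N \<Rightarrow> play S A n @ [(N, A (play S A n) N)])"

text \<open>Against every algorithm, \<open>S\<close> stops after finitely many rounds, having presented a
  \<open>\<sigma>\<close>-interval graph of clique number at most \<open>\<omega>\<close> on which at least \<open>k\<close> colours were used.\<close>

definition forces_colours :: "strategy \<Rightarrow> real \<Rightarrow> nat \<Rightarrow> real \<Rightarrow> bool" where
  "forces_colours S \<sigma> \<omega> k \<longleftrightarrow>
     (\<forall>A. online_colouring_algorithm A \<longrightarrow>
        (\<exists>n. let p = play S A n in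
           S p = None \<and>
           sigma_interval_graph \<sigma> (verts p) (adj p) \<and>
           clique_number (verts p) (adj p) \<le> \<omega> \<and>
           k \<le> real (card (colour p ` verts p))))"

end

theory Submission
  imports Defs "HOL-Library.Sublist"
begin

text \<open>
  Suppose the adversary can force \<open>c\<close> colours with clique number \<open>w\<close> inside a component of span
  \<open>L\<close>. By the pigeonhole principle it can produce many copies using one and the same colour set
  \<open>P\<close>, since otherwise the algorithm has spent enough colours already. It covers some copies by a
  clique of \<open>w\<close> new intervals and finds, again by pigeonhole, two of these cliques with the same
  colour set \<open>X\<close>. It places the two at the ends of a row of four copies, whose two middle copies
  are bare. A clique covering the second copy and touching the first covering clique sees \<open>P\<close> and
  \<open>X\<close>, hence needs \<open>w\<close> new colours \<open>Y\<close>; a clique covering the third copy and touching both the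
  previous clique and the last covering clique sees \<open>P\<close>, \<open>X\<close> and \<open>Y\<close>, hence needs \<open>w\<close> more.
  This forces \<open>c + 3 w\<close> colours with clique number \<open>2 w\<close> in span about \<open>4 L\<close>.

  Starting from a clique of size \<open>w\<close>, after \<open>t\<close> rounds the ratio of colours to clique number is
  \<open>3 - 2 / 2 ^ t\<close>, with intervals no longer than \<open>4 ^ t\<close>. The least \<open>t\<close> with
  \<open>2 / 2 ^ t < \<epsilon>\<close> has \<open>4 ^ t \<le> 16 / \<epsilon>\<^sup>2 < \<sigma>\<close>, and the strict
  inequality absorbs the rounding in \<open>w = \<omega> div 2 ^ t\<close> for large \<open>\<omega>\<close>.
\<close>

section \<open>Forcing as a property of positions, and extraction of strategies\<close>

text \<open>The adversary can steer the game from a position to one satisfying \<open>P\<close>, whatever colours the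
  algorithm chooses. This is a property of positions that does not mention an algorithm, so that the
  pigeonhole arguments can be carried out on it; the strategy is extracted only at the end.\<close>

inductive can_force :: "(position \<Rightarrow> bool) \<Rightarrow> position \<Rightarrow> bool" for P where
  stop: "P p \<Longrightarrow> can_force P p"
| move: "N \<subseteq> verts p \<Longrightarrow> (\<And>c. c \<notin> colour p ` N \<Longrightarrow> can_force P (p @ [(N, c)])) \<Longrightarrow> can_force P p"

lemma can_force_trans:
  assumes "can_force P p" "\<And>q. P q \<Longrightarrow> can_force Q q"
  shows "can_force Q p"
  using assms by (induction rule: can_force.induct) (auto intro: can_force.move)

text \<open>Generalises \<open>play\<close> to an arbitrary starting position: the induction over
  \<open>can_force\<close> peels off the first move, whereas \<open>play\<close> recurses on the
  last one.\<close>

primrec play_from :: "strategy \<Rightarrow> algorithm \<Rightarrow> position \<Rightarrow> nat \<Rightarrow> position" where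
  "play_from S A p 0 = p"
| "play_from S A p (Suc n) =
     (case S (play_from S A p n) of
        None \<Rightarrow> play_from S A p n
      | Some N \<Rightarrow> play_from S A p n @ [(N, A (play_from S A p n) N)])"

lemma play_from_Nil: "play_from S A [] n = play S A n"
  by (induction n) (auto split: option.split)

lemma play_from_step:
  assumes "S p = Some N"
  shows "play_from S A p (Suc n) = play_from S A (p @ [(N, A p N)]) n"
  using assms by (induction n) (auto split: option.split)

lemma prefix_play_from: "prefix p (play_from S A p n)"
  by (induction n) (auto split: option.split intro: prefix_order.trans)

lemma play_from_cong:
  assumes "\<And>q. prefix p q \<Longrightarrow> S q = T q"
  shows "play_from S A p n = play_from T A p n"
  by (induction n) (auto simp: assms prefix_play_from split: option.split)

text \<open>Induction over the forcing tree: at a node the strategy plays \<open>N\<close> and hands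
  over to the strategy of the subtree picked by the answer. One strategy serves all algorithms
  because the answer is recorded in the position.\<close>

lemma can_force_strategy:
  assumes "can_force P p"
  shows "\<exists>S. online_strategy S \<and> (\<forall>A. online_colouring_algorithm A \<longrightarrow>
           (\<exists>n. P (play_from S A p n) \<and> S (play_from S A p n) = None))"
  using assms
proof (induction rule: can_force.induct)
  case (stop p)
  have "online_strategy (\<lambda>_. None)"
    by (simp add: online_strategy_def)
  moreover have "P (play_from (\<lambda>_. None) A p 0)" for A
    using stop by simp
  ultimately show ?case by blast
next
  case (move N p)
  then obtain T where T: "\<And>c. c \<notin> colour p ` N \<Longrightarrow> online_strategy (T c) \<and>
      (\<forall>A. online_colouring_algorithm A \<longrightarrow>
        (\<exists>n. P (play_from (T c) A (p @ [(N, c)]) n) \<and> T c (play_from (T c) A (p @ [(N, c)]) n) = None))"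
    by metis
  \<comment> \<open>The answer to the move \<open>N\<close> is the colour stored at index
    \<open>length p\<close>; it selects the subtree. All other positions get \<open>None\<close>,
    which keeps \<open>S\<close> an \<open>online_strategy\<close>.\<close>
  define S where "S q = (if q = p then Some N
      else if prefix p q \<and> snd (q ! length p) \<notin> colour p ` N then T (snd (q ! length p)) q
      else None)" for q
  have "online_strategy S"
    using T move(1) by (auto simp: online_strategy_def S_def)
  moreover have "\<exists>n. P (play_from S A p n) \<and> S (play_from S A p n) = None"
    if A: "online_colouring_algorithm A" for A
  proof -
    define c where "c = A p N"
    let ?p' = "p @ [(N, c)]"
    have c: "c \<notin> colour p ` N"
      using A move(1) by (auto simp: online_colouring_algorithm_def c_def)
    have agree: "S q = T c q" if "prefix ?p' q" for q
      using that c by (auto simp: S_def prefix_def nth_append)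
    obtain n where n: "P (play_from (T c) A ?p' n)" "T c (play_from (T c) A ?p' n) = None"
      using T c A by blast
    have "play_from S A p (Suc n) = play_from S A ?p' n"
      unfolding c_def by (rule play_from_step) (simp add: S_def)
    also have "\<dots> = play_from (T c) A ?p' n"
      by (rule play_from_cong) (rule agree)
    finally have "play_from S A p (Suc n) = play_from (T c) A ?p' n" .
    with n show ?thesis
      by (metis agree prefix_play_from)
  qed
  ultimately show ?case by blast
qed

section \<open>Presenting a clique joined to a given vertex set\<close>

text \<open>The clique of \<open>m\<close> new vertices presented here is also joined to every vertex of \<open>N\<close>.\<close>

definition block_extension :: "position \<Rightarrow> nat set \<Rightarrow> nat \<Rightarrow> position \<Rightarrow> bool" where
  "block_extension p N m q \<longleftrightarrow> prefix p q \<and> length q = length p + m \<and>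
     (\<forall>v\<in>{length p..<length q}. fst (q ! v) = N \<union> {length p..<v}) \<and>
     inj_on (colour q) {length p..<length q} \<and>
     colour q ` {length p..<length q} \<inter> colour p ` N = {}"

lemma colour_prefix: "prefix p q \<Longrightarrow> v < length p \<Longrightarrow> colour q v = colour p v"
  by (auto simp: prefix_def colour_def nth_append)

lemma colour_image_prefix: "prefix p q \<Longrightarrow> U \<subseteq> verts p \<Longrightarrow> colour q ` U = colour p ` U"
  by (rule image_cong) (auto simp: colour_prefix verts_def)

lemma adj_prefix: "prefix p q \<Longrightarrow> u < length p \<Longrightarrow> v < length p \<Longrightarrow> adj q u v \<longleftrightarrow> adj p u v"
  by (auto simp: prefix_def adj_def nth_append)

lemma adj_sym: "adj p u v \<longleftrightarrow> adj p v u"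
  by (auto simp: adj_def)

text \<open>One vertex per move, joined to \<open>N\<close> and to the new vertices so far: any
  legal colour then avoids those of \<open>N\<close> and repeats none within the block.\<close>

lemma can_force_block:
  assumes N: "N \<subseteq> verts p"
  shows "can_force (block_extension p N m) p"
proof (induction m)
  case 0
  show ?case
    by (rule can_force.stop) (simp add: block_extension_def)
next
  case (Suc m)
  show ?case
  proof (rule can_force_trans[OF Suc])
    fix q assume q: "block_extension p N m q"
    let ?N = "N \<union> {length p..<length q}"
    have pq: "prefix p q" and len: "length q = length p + m"
      using q by (auto simp: block_extension_def)
    have new: "block_extension p N (Suc m) (q @ [(?N, c)])" if c: "c \<notin> colour q ` ?N" for c
    proof -
      let ?q = "q @ [(?N, c)]"
      have old: "colour ?q v = colour q v" if "v < length q" for v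
        using that by (simp add: colour_def nth_append)
      have last: "colour ?q (length q) = c"
        by (simp add: colour_def)
      have iv: "{length p..<length ?q} = insert (length q) {length p..<length q}"
        using len by auto
      have im: "colour ?q ` {length p..<length q} = colour q ` {length p..<length q}"
        by (rule image_cong) (auto simp: old)
      have imN: "colour q ` N = colour p ` N"
        by (rule colour_image_prefix[OF pq N])
      have "inj_on (colour ?q) {length p..<length q}"
        using q old by (auto simp: block_extension_def inj_on_def)
      hence "inj_on (colour ?q) {length p..<length ?q}"
        unfolding iv using c im last by (auto simp: image_Un)
      moreover have "colour ?q ` {length p..<length ?q} \<inter> colour p ` N = {}"
        unfolding iv image_insert im last using q c by (simp add: block_extension_def image_Un imN len)
      moreover have "fst (?q ! v) = N \<union> {length p..<v}" if "v \<in> {length p..<length ?q}" for v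
      proof (cases "v = length q")
        case False
        with that have "v \<in> {length p..<length q}" by auto
        with q show ?thesis by (auto simp: block_extension_def nth_append)
      qed simp
      ultimately show ?thesis
        using pq len by (simp add: block_extension_def)
    qed
    have "?N \<subseteq> verts q"
      using N len by (auto simp: verts_def)
    then show "can_force (block_extension p N (Suc m)) q"
      by (rule can_force.move) (auto intro!: can_force.stop new)
  qed
qed

lemma adj_block_old:
  assumes "block_extension p N m q" "u < length p" "v \<in> {length p..<length q}"
  shows "adj q u v \<longleftrightarrow> u \<in> N"
  using assms by (auto simp: block_extension_def adj_def)

lemma adj_block_new:
  assumes "block_extension p N m q" "u \<in> {length p..<length q}" "v \<in> {length p..<length q}" "u \<noteq> v"
  shows "adj q u v"
  using assms by (auto simp: block_extension_def adj_def)

section \<open>Extensions that leave earlier components untouched\<close>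

definition fresh_extension :: "position \<Rightarrow> position \<Rightarrow> bool" where
  "fresh_extension p q \<longleftrightarrow> prefix p q \<and> (\<forall>v\<in>{length p..<length q}. fst (q ! v) \<inter> verts p = {})"

lemma fresh_extension_refl: "fresh_extension p p"
  by (simp add: fresh_extension_def)

lemma fresh_extension_trans:
  assumes "fresh_extension p q" "fresh_extension q r"
  shows "fresh_extension p r"
proof -
  have pq: "prefix p q" and qr: "prefix q r"
    using assms by (auto simp: fresh_extension_def)
  have "fst (r ! v) \<inter> verts p = {}" if v: "v \<in> {length p..<length r}" for v
  proof (cases "v < length q")
    case True
    then have "r ! v = q ! v"
      using qr by (auto simp: prefix_def nth_append)
    with True v assms show ?thesis
      by (auto simp: fresh_extension_def)
  next
    case False
    have "verts p \<subseteq> verts q"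
      using prefix_length_le[OF pq] by (auto simp: verts_def)
    moreover have "fst (r ! v) \<inter> verts q = {}"
      using False v assms(2) by (auto simp: fresh_extension_def)
    ultimately show ?thesis by blast
  qed
  then show ?thesis
    using pq qr by (auto simp: fresh_extension_def intro: prefix_order.trans)
qed

text \<open>A block may attach to vertices newer than \<open>p\<close>, so gadgets can be assembled
  after \<open>p\<close> without disturbing what \<open>p\<close> contains.\<close>

lemma fresh_extension_block:
  assumes "fresh_extension p q" "block_extension q N m r" "N \<inter> verts p = {}"
  shows "fresh_extension p r"
proof -
  have pq: "prefix p q" and qr: "prefix q r"
    using assms by (auto simp: fresh_extension_def block_extension_def)
  have "fst (r ! v) \<inter> verts p = {}" if v: "v \<in> {length p..<length r}" for v
  proof (cases "v < length q")
    case True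
    then have "r ! v = q ! v"
      using qr by (auto simp: prefix_def nth_append)
    with True v assms show ?thesis
      by (auto simp: fresh_extension_def)
  next
    case False
    then have "fst (r ! v) = N \<union> {length q..<v}"
      using v assms(2) by (auto simp: block_extension_def)
    then show ?thesis
      using assms(3) prefix_length_le[OF pq] by (auto simp: verts_def)
  qed
  then show ?thesis
    using pq qr by (auto simp: fresh_extension_def intro: prefix_order.trans)
qed

definition isolated :: "position \<Rightarrow> nat set \<Rightarrow> bool" where
  "isolated p U \<longleftrightarrow> (\<forall>u\<in>U. \<forall>v. adj p u v \<longrightarrow> v \<in> U)"

text \<open>This lets gadgets collected earlier survive while later ones are built: a new edge at
  \<open>U\<close> would have to come from a vertex of the extension with an old neighbour.\<close>

lemma isolated_fresh:
  assumes "isolated p U" "U \<subseteq> verts p" "fresh_extension p q"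
  shows "isolated q U"
  unfolding isolated_def
proof (intro ballI allI impI)
  fix u v assume u: "u \<in> U" and a: "adj q u v"
  have "v < length p"
  proof (rule ccontr)
    assume "\<not> v < length p"
    with a u assms have "u \<in> fst (q ! v)" "v \<in> {length p..<length q}" "u \<in> verts p"
      by (auto simp: adj_def verts_def)
    with assms(3) show False
      by (auto simp: fresh_extension_def)
  qed
  then have "adj p u v"
    using a u assms adj_prefix by (auto simp: fresh_extension_def verts_def)
  with u assms(1) show "v \<in> U"
    by (auto simp: isolated_def)
qed

subsection \<open>Interval representations and cliques\<close>

text \<open>A bound on each clique rather than a \<open>Max\<close>, so that it passes to subsets
  and adds up over unions without finiteness conditions.\<close>

definition cliques_le :: "position \<Rightarrow> nat set \<Rightarrow> nat \<Rightarrow> bool" where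
  "cliques_le p U w \<longleftrightarrow> (\<forall>C. is_clique U (adj p) C \<longrightarrow> card C \<le> w)"

text \<open>Intersection is expressed through endpoints, which reduces layouts to linear arithmetic;
  the length bound makes intervals nonempty, so that \<open>intervals_meet_iff\<close>
  applies.\<close>

definition interval_rep :: "real \<Rightarrow> position \<Rightarrow> nat set \<Rightarrow> (nat \<Rightarrow> real) \<Rightarrow> (nat \<Rightarrow> real) \<Rightarrow> bool" where
  "interval_rep \<sigma> p U l r \<longleftrightarrow>
     (\<forall>v\<in>U. 1 \<le> r v - l v \<and> r v - l v < \<sigma>) \<and>
     (\<forall>u\<in>U. \<forall>v\<in>U. u \<noteq> v \<longrightarrow> (adj p u v \<longleftrightarrow> l u \<le> r v \<and> l v \<le> r u))"

lemma intervals_meet_iff: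
  fixes a b c d :: real
  assumes "a \<le> b" "c \<le> d"
  shows "{a..b} \<inter> {c..d} \<noteq> {} \<longleftrightarrow> a \<le> d \<and> c \<le> b"
  using assms by (auto simp: Int_atLeastAtMost)

lemma sigma_interval_graphI:
  assumes "finite U" "interval_rep \<sigma> p U l r"
  shows "sigma_interval_graph \<sigma> U (adj p)"
proof -
  have "l v \<le> r v" if "v \<in> U" for v
    using assms(2) that by (fastforce simp: interval_rep_def)
  then have "\<forall>u\<in>U. \<forall>v\<in>U. u \<noteq> v \<longrightarrow> (adj p u v \<longleftrightarrow> {l u..r u} \<inter> {l v..r v} \<noteq> {})"
    using assms(2) unfolding interval_rep_def by (metis intervals_meet_iff)
  then show ?thesis
    using assms unfolding sigma_interval_graph_def interval_rep_def by blast
qed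

lemma clique_number_le:
  assumes "finite U" "cliques_le p U w"
  shows "clique_number U (adj p) \<le> w"
proof -
  have "finite {C. is_clique U (adj p) C}"
    using assms(1) by (rule_tac finite_subset[of _ "Pow U"]) (auto simp: is_clique_def)
  moreover have "is_clique U (adj p) {}"
    by (simp add: is_clique_def)
  ultimately show ?thesis
    using assms(2) unfolding clique_number_def by (subst Max_le_iff) (auto simp: cliques_le_def)
qed

lemma cliques_le_subset: "cliques_le p U w \<Longrightarrow> V \<subseteq> U \<Longrightarrow> cliques_le p V w"
  by (auto simp: cliques_le_def is_clique_def)

lemma cliques_le_mono: "cliques_le p U w \<Longrightarrow> w \<le> w' \<Longrightarrow> cliques_le p U w'"
  unfolding cliques_le_def by (meson order_trans)

lemma cliques_le_card: "finite U \<Longrightarrow> card U \<le> w \<Longrightarrow> cliques_le p U w"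
  unfolding cliques_le_def is_clique_def by (meson card_mono order_trans)

lemma cliques_le_Un:
  assumes "cliques_le p U a" "cliques_le p V b"
  shows "cliques_le p (U \<union> V) (a + b)"
  unfolding cliques_le_def
proof (intro allI impI)
  fix C assume C: "is_clique (U \<union> V) (adj p) C"
  have "card (C \<inter> U) \<le> a" "card (C \<inter> V) \<le> b"
    using assms C by (auto simp: cliques_le_def is_clique_def)
  moreover have "C = (C \<inter> U) \<union> (C \<inter> V)"
    using C by (auto simp: is_clique_def)
  ultimately show "card C \<le> a + b"
    by (metis card_Un_le add_mono order_trans)
qed

lemma cliques_le_separate:
  assumes "cliques_le p U w" "cliques_le p V w" "\<And>u v. u \<in> U \<Longrightarrow> v \<in> V \<Longrightarrow> \<not> adj p u v"
    "U \<inter> V = {}"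
  shows "cliques_le p (U \<union> V) w"
  unfolding cliques_le_def
proof (intro allI impI)
  fix C assume C: "is_clique (U \<union> V) (adj p) C"
  have "C \<subseteq> U \<or> C \<subseteq> V"
  proof (rule ccontr)
    assume "\<not> (C \<subseteq> U \<or> C \<subseteq> V)"
    then obtain u v where uv: "u \<in> C" "u \<in> U" "v \<in> C" "v \<in> V"
      using C by (auto simp: is_clique_def)
    moreover have "u \<noteq> v"
      using uv assms(4) by auto
    ultimately have "adj p u v"
      using C by (simp add: is_clique_def)
    with uv assms(3) show False
      by simp
  qed
  then have "is_clique U (adj p) C \<or> is_clique V (adj p) C"
    using C by (auto simp: is_clique_def)
  with assms(1,2) show "card C \<le> w"
    by (auto simp: cliques_le_def)
qed

lemma cliques_le_prefix:
  assumes "prefix p q" "U \<subseteq> verts p"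
  shows "cliques_le q U w \<longleftrightarrow> cliques_le p U w"
proof -
  have "is_clique U (adj q) C \<longleftrightarrow> is_clique U (adj p) C" for C
    using assms adj_prefix[OF assms(1)] unfolding is_clique_def verts_def
    by (meson lessThan_iff subsetD)
  then show ?thesis
    by (simp add: cliques_le_def)
qed

lemma interval_rep_prefix:
  assumes "prefix p q" "U \<subseteq> verts p"
  shows "interval_rep \<sigma> q U l r \<longleftrightarrow> interval_rep \<sigma> p U l r"
proof -
  have "adj q u v \<longleftrightarrow> adj p u v" if "u \<in> U" "v \<in> U" for u v
    using adj_prefix[OF assms(1)] assms(2) that by (auto simp: verts_def)
  then show ?thesis
    by (simp add: interval_rep_def)
qed

lemma interval_rep_subset: "interval_rep \<sigma> p U l r \<Longrightarrow> V \<subseteq> U \<Longrightarrow> interval_rep \<sigma> p V l r"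
  by (auto simp: interval_rep_def)

lemma interval_rep_shift:
  "interval_rep \<sigma> p U (\<lambda>v. a + l v) (\<lambda>v. a + r v) \<longleftrightarrow> interval_rep \<sigma> p U l r"
  by (simp add: interval_rep_def)

lemma interval_rep_cong:
  assumes "\<And>v. v \<in> U \<Longrightarrow> l v = l' v" "\<And>v. v \<in> U \<Longrightarrow> r v = r' v"
  shows "interval_rep \<sigma> p U l r \<longleftrightarrow> interval_rep \<sigma> p U l' r'"
  using assms by (auto simp: interval_rep_def)

lemma interval_rep_Un:
  assumes "interval_rep \<sigma> p U l r" "interval_rep \<sigma> p V l r"
    and "\<And>u v. u \<in> U \<Longrightarrow> v \<in> V \<Longrightarrow> adj p u v \<longleftrightarrow> l u \<le> r v \<and> l v \<le> r u"
  shows "interval_rep \<sigma> p (U \<union> V) l r"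
proof -
  have "adj p u v \<longleftrightarrow> l u \<le> r v \<and> l v \<le> r u" if "u \<in> U \<union> V" "v \<in> U \<union> V" "u \<noteq> v" for u v
    using that assms(1,2) assms(3)[of u v] assms(3)[of v u] adj_sym[of p u v]
    unfolding interval_rep_def by blast
  then show ?thesis
    using assms(1,2) unfolding interval_rep_def by blast
qed

lemma interval_rep_separate:
  assumes U: "interval_rep \<sigma> p U l r" and V: "interval_rep \<sigma> p V l' r'"
    and fin: "finite U" "finite V" and disj: "U \<inter> V = {}"
    and noadj: "\<And>u v. u \<in> U \<Longrightarrow> v \<in> V \<Longrightarrow> \<not> adj p u v"
  shows "\<exists>l r. interval_rep \<sigma> p (U \<union> V) l r"
proof -
  obtain a where a: "\<And>u. u \<in> U \<Longrightarrow> r u \<le> a"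
    using fin(1) bdd_above_finite[of "r ` U"] by (auto simp: bdd_above_def)
  obtain b where b: "\<And>v. v \<in> V \<Longrightarrow> b \<le> l' v"
    using fin(2) bdd_below_finite[of "l' ` V"] by (auto simp: bdd_below_def)
  \<comment> \<open>The shift takes the lower bound \<open>b\<close> of \<open>V\<close> to
    \<open>a + 1\<close>, strictly to the right of all of \<open>U\<close>.\<close>
  define d where "d = a - b + 1"
  define L where "L v = (if v \<in> U then l v else d + l' v)" for v
  define R where "R v = (if v \<in> U then r v else d + r' v)" for v
  have "interval_rep \<sigma> p U L R"
    using U by (subst interval_rep_cong[of _ _ l _ r]) (auto simp: L_def R_def)
  moreover have "interval_rep \<sigma> p V L R"
    using V disj by (subst interval_rep_cong[of _ _ "\<lambda>v. d + l' v" _ "\<lambda>v. d + r' v"])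
      (auto simp: L_def R_def interval_rep_shift)
  moreover have "adj p u v \<longleftrightarrow> L u \<le> R v \<and> L v \<le> R u" if "u \<in> U" "v \<in> V" for u v
  proof -
    have "v \<notin> U" using that disj by auto
    then show ?thesis
      using noadj[OF that] a[OF that(1)] b[OF that(2)] that(1) by (simp add: L_def R_def d_def)
  qed
  ultimately show ?thesis
    using interval_rep_Un by blast
qed

subsection \<open>Chains of covered tiles\<close>

text \<open>\<open>E\<close> collects the intervals ending exactly at the right border \<open>M\<close>, which is where the next
  covering clique touches the chain.\<close>

definition chain :: "real \<Rightarrow> nat \<Rightarrow> position \<Rightarrow> nat set \<Rightarrow> nat set \<Rightarrow> real \<Rightarrow> bool" where
  "chain \<sigma> w p U E M \<longleftrightarrow> finite U \<and> E \<subseteq> U \<and> card E \<le> w \<and> cliques_le p U (2 * w) \<and>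
     (\<exists>l r. interval_rep \<sigma> p U l r \<and> (\<forall>u\<in>U. 0 \<le> l u \<and> r u \<le> M \<and> (r u = M \<longleftrightarrow> u \<in> E)))"

lemma chain_empty: "chain \<sigma> w p {} {} M"
  by (simp add: chain_def cliques_le_card interval_rep_def)

text \<open>The tile \<open>T\<close> is translated by \<open>M + 1\<close>, and each vertex of
  \<open>C\<close> gets the interval from \<open>M\<close> to \<open>M + L + 2\<close>. Thus
  \<open>C\<close> contains the tile, meets the old chain exactly in the intervals of
  \<open>E\<close>, and alone reaches the new border. Its length is the reason for
  \<open>L + 2 < \<sigma>\<close>.\<close>

lemma chain_link:
  assumes ch: "chain \<sigma> w p U E M" and M: "0 \<le> M" and L: "0 \<le> L" "L + 2 < \<sigma>"
    and T: "finite T" "cliques_le p T w" "interval_rep \<sigma> p T l r" "\<And>t. t \<in> T \<Longrightarrow> 0 \<le> l t \<and> r t \<le> L"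
    and C: "finite C" "card C \<le> w" "\<And>c d. c \<in> C \<Longrightarrow> d \<in> C \<Longrightarrow> c \<noteq> d \<Longrightarrow> adj p c d"
    and disj: "U \<inter> T = {}" "U \<inter> C = {}" "T \<inter> C = {}"
    and UT: "\<And>u t. u \<in> U \<Longrightarrow> t \<in> T \<Longrightarrow> \<not> adj p u t"
    and TC: "\<And>t c. t \<in> T \<Longrightarrow> c \<in> C \<Longrightarrow> adj p t c"
    and UC: "\<And>u c. u \<in> U \<Longrightarrow> c \<in> C \<Longrightarrow> adj p u c \<longleftrightarrow> u \<in> E"
  shows "chain \<sigma> w p (U \<union> T \<union> C) C (M + L + 2)"
proof -
  obtain lU rU where U: "interval_rep \<sigma> p U lU rU"
      "\<And>u. u \<in> U \<Longrightarrow> 0 \<le> lU u \<and> rU u \<le> M \<and> (rU u = M \<longleftrightarrow> u \<in> E)"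
    and E: "finite U" "E \<subseteq> U" "card E \<le> w" "cliques_le p U (2 * w)"
    using ch by (auto simp: chain_def)
  define l' where "l' v = (if v \<in> U then lU v else if v \<in> T then (M + 1) + l v else M)" for v
  define r' where "r' v = (if v \<in> U then rU v else if v \<in> T then (M + 1) + r v else M + L + 2)" for v
  have onU: "l' v = lU v" "r' v = rU v" if "v \<in> U" for v
    using that by (auto simp: l'_def r'_def)
  have onT: "l' v = (M + 1) + l v" "r' v = (M + 1) + r v" if "v \<in> T" for v
    using that disj by (auto simp: l'_def r'_def)
  have onC: "l' v = M" "r' v = M + L + 2" if "v \<in> C" for v
    using that disj by (auto simp: l'_def r'_def)
  have lenU: "lU v \<le> rU v" if "v \<in> U" for v
    using U(1) that by (fastforce simp: interval_rep_def)
  have lenT: "l v \<le> r v" if "v \<in> T" for v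
    using T(3) that by (fastforce simp: interval_rep_def)
  have repU: "interval_rep \<sigma> p U l' r'"
    using U(1) interval_rep_cong[of U l' lU r' rU \<sigma> p] onU by simp
  have repT: "interval_rep \<sigma> p T l' r'"
    using T(3) interval_rep_cong[of T l' "\<lambda>v. (M + 1) + l v" r' "\<lambda>v. (M + 1) + r v" \<sigma> p] onT
    by (simp only: interval_rep_shift)
  have repC: "interval_rep \<sigma> p C l' r'"
    using C(3) L M onC by (simp add: interval_rep_def)
  have repUT: "interval_rep \<sigma> p (U \<union> T) l' r'"
  proof (rule interval_rep_Un[OF repU repT])
    fix u t assume ut: "u \<in> U" "t \<in> T"
    then show "adj p u t \<longleftrightarrow> l' u \<le> r' t \<and> l' t \<le> r' u"
      using UT[OF ut] U(2)[OF ut(1)] T(4)[OF ut(2)] by (simp add: onU onT)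
  qed
  have rep: "interval_rep \<sigma> p (U \<union> T \<union> C) l' r'"
  proof (rule interval_rep_Un[OF repUT repC])
    fix v c assume v: "v \<in> U \<union> T" and c: "c \<in> C"
    show "adj p v c \<longleftrightarrow> l' v \<le> r' c \<and> l' c \<le> r' v"
    proof (cases "v \<in> U")
      case True
      then show ?thesis
        using UC[OF True c] U(2)[OF True] lenU[OF True] c L(1) by (auto simp: onU onC)
    next
      case False
      with v have t: "v \<in> T" by simp
      then show ?thesis
        using TC[OF t c] T(4)[OF t] lenT[OF t] c L(1) by (auto simp: onT onC)
    qed
  qed
  have ends: "0 \<le> l' v \<and> r' v \<le> M + L + 2 \<and> (r' v = M + L + 2 \<longleftrightarrow> v \<in> C)" if v: "v \<in> U \<union> T \<union> C" for v
  proof -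
    consider "v \<in> U" | "v \<in> T" | "v \<in> C" using v by blast
    then show ?thesis
    proof cases
      case 1
      then have "v \<notin> C" using disj by blast
      with 1 U(2)[OF 1] L show ?thesis by (simp add: onU)
    next
      case 2
      then have "v \<notin> C" using disj by blast
      with 2 T(4)[OF 2] M show ?thesis by (simp add: onT)
    next
      case 3
      with M L show ?thesis by (simp add: onC)
    qed
  qed
  \<comment> \<open>No edge joins \<open>T\<close> to \<open>U\<close>, and \<open>C\<close> sees
    only \<open>E\<close> inside \<open>U\<close>. So a clique lies in \<open>T \<union> C\<close>
    or \<open>E \<union> C\<close>, both made of two parts of clique number at most
    \<open>w\<close>, or entirely in \<open>U\<close>.\<close>
  have "cliques_le p (U \<union> T \<union> C) (2 * w)"
    unfolding cliques_le_def
  proof (intro allI impI)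
    fix Q assume Q: "is_clique (U \<union> T \<union> C) (adj p) Q"
    have QQ: "Q \<subseteq> U \<union> T \<union> C" "\<And>u v. u \<in> Q \<Longrightarrow> v \<in> Q \<Longrightarrow> u \<noteq> v \<Longrightarrow> adj p u v"
      using Q by (auto simp: is_clique_def)
    have "cliques_le p (T \<union> C) (w + w)"
      by (rule cliques_le_Un[OF T(2) cliques_le_card[OF C(1,2)]])
    moreover have "cliques_le p (E \<union> C) (w + w)"
      by (rule cliques_le_Un[OF cliques_le_card[OF finite_subset[OF E(2,1)] E(3)] cliques_le_card[OF C(1,2)]])
    moreover have "Q \<subseteq> T \<union> C \<or> Q \<subseteq> E \<union> C \<or> Q \<subseteq> U"
    proof (cases "Q \<inter> T = {}")
      case False
      then show ?thesis using QQ UT disj by blast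
    next
      case noT: True
      show ?thesis
      proof (cases "Q \<inter> C = {}")
        case True
        then show ?thesis using QQ noT by blast
      next
        case False
        then show ?thesis using QQ noT UC disj by blast
      qed
    qed
    moreover have "is_clique V (adj p) Q" if "Q \<subseteq> V" for V
      using QQ(2) that by (simp add: is_clique_def)
    ultimately show "card Q \<le> 2 * w"
      using E(4) unfolding cliques_le_def mult_2 by blast
  qed
  then show ?thesis
    using rep ends E(1) C(1,2) T(1) unfolding chain_def by blast
qed

section \<open>Tiles and their covering cliques\<close>

definition tile :: "real \<Rightarrow> nat \<Rightarrow> real \<Rightarrow> nat \<Rightarrow> position \<Rightarrow> nat set \<Rightarrow> nat set \<Rightarrow> bool" where
  "tile \<sigma> w L c p U P \<longleftrightarrow> U \<subseteq> verts p \<and> cliques_le p U w \<and> colour p ` U = P \<and> c \<le> card P \<and>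
     (\<exists>l r. interval_rep \<sigma> p U l r \<and> (\<forall>u\<in>U. 0 \<le> l u \<and> r u \<le> L))"

lemma tile_prefix:
  assumes "tile \<sigma> w L c p U P" "prefix p q"
  shows "tile \<sigma> w L c q U P"
proof -
  have U: "U \<subseteq> verts p"
    using assms(1) by (simp add: tile_def)
  moreover have "verts p \<subseteq> verts q"
    using prefix_length_le[OF assms(2)] by (simp add: verts_def)
  ultimately have "U \<subseteq> verts q"
    by blast
  then show ?thesis
    using assms(1) cliques_le_prefix[OF assms(2) U] interval_rep_prefix[OF assms(2) U]
      colour_image_prefix[OF assms(2) U]
    by (simp add: tile_def)
qed

definition cover :: "nat \<Rightarrow> position \<Rightarrow> nat set \<Rightarrow> nat set \<Rightarrow> bool" where
  "cover w p A C \<longleftrightarrow> C \<subseteq> verts p \<and> A \<inter> C = {} \<and> card C = w \<and>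
     (\<forall>c\<in>C. \<forall>d\<in>C. c \<noteq> d \<longrightarrow> adj p c d) \<and> (\<forall>a\<in>A. \<forall>c\<in>C. adj p a c) \<and>
     card (colour p ` C) = w \<and> colour p ` A \<inter> colour p ` C = {}"

lemma cover_prefix:
  assumes "cover w p A C" "prefix p q" "A \<subseteq> verts p"
  shows "cover w q A C"
proof -
  have C: "C \<subseteq> verts p"
    using assms(1) by (simp add: cover_def)
  have "verts p \<subseteq> verts q"
    using prefix_length_le[OF assms(2)] by (simp add: verts_def)
  moreover have "adj q u v \<longleftrightarrow> adj p u v" if "u \<in> A \<union> C" "v \<in> C" for u v
    using adj_prefix[OF assms(2), of u v] that C assms(3) by (auto simp: verts_def)
  ultimately show ?thesis
    using assms(1) C colour_image_prefix[OF assms(2) C] colour_image_prefix[OF assms(2,3)]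
    unfolding cover_def by simp
qed

lemma cover_block:
  assumes "block_extension p N w q" "N \<subseteq> verts p"
  shows "cover w q N {length p..<length q}"
proof -
  have "prefix p q" using assms(1) by (simp add: block_extension_def)
  moreover have "adj q a c" if "a \<in> N" "c \<in> {length p..<length q}" for a c
    using adj_block_old[OF assms(1) _ that(2)] that assms(2) by (auto simp: verts_def)
  moreover have "colour q ` N \<inter> colour q ` {length p..<length q} = {}"
    using assms colour_image_prefix[of p q N] unfolding block_extension_def by (metis Int_commute)
  moreover have "card (colour q ` {length p..<length q}) = w" "length q = length p + w"
    using assms by (auto simp: block_extension_def card_image)
  ultimately show ?thesis
    using assms(2) adj_block_new[OF assms(1)] by (auto simp: cover_def verts_def)
qed

text \<open>In the doubling step a covering clique is joined to more than the copy beneath it; as a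
  link of the chain it counts as a cover of that copy only.\<close>

lemma cover_mono:
  assumes "cover w p A C" "B \<subseteq> A"
  shows "cover w p B C"
proof -
  have "colour p ` B \<subseteq> colour p ` A"
    using assms(2) by (rule image_mono)
  then have "colour p ` B \<inter> colour p ` C = {}"
    using assms(1) unfolding cover_def by fast
  then show ?thesis
    using assms unfolding cover_def by (simp add: subset_iff disjoint_iff)
qed

lemma chain_link_tile:
  assumes "chain \<sigma> w p U E M" "0 \<le> M" "0 \<le> L" "L + 2 < \<sigma>"
    and tile: "tile \<sigma> w L c p T P" and cover: "cover w p T C"
    and "U \<inter> T = {}" "U \<inter> C = {}"
    and "\<And>u t. u \<in> U \<Longrightarrow> t \<in> T \<Longrightarrow> \<not> adj p u t"
    and "\<And>u c. u \<in> U \<Longrightarrow> c \<in> C \<Longrightarrow> adj p u c \<longleftrightarrow> u \<in> E"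
  shows "chain \<sigma> w p (U \<union> T \<union> C) C (M + L + 2)"
proof -
  obtain l r where "interval_rep \<sigma> p T l r" "\<And>u. u \<in> T \<Longrightarrow> 0 \<le> l u \<and> r u \<le> L"
    using tile by (auto simp: tile_def)
  moreover have "finite T" "cliques_le p T w" "finite C"
    using tile cover finite_subset by (auto simp: tile_def cover_def verts_def)
  ultimately show ?thesis
    using assms(1-4,7-) cover by (intro chain_link[of \<sigma> w p U E M L T l r]) (auto simp: cover_def)
qed

lemma isolatedD: "isolated p U \<Longrightarrow> u \<in> U \<Longrightarrow> v \<notin> U \<Longrightarrow> \<not> adj p u v"
  by (auto simp: isolated_def)

section \<open>Gadgets, matched by their colour sets\<close>

text \<open>\<open>A\<close> is a copy that is already covered by the clique \<open>C\<close>, while the copy \<open>B\<close> is kept bare for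
  a later covering clique that is to touch \<open>C\<close>.\<close>

definition covered_pair ::
    "real \<Rightarrow> nat \<Rightarrow> real \<Rightarrow> nat \<Rightarrow> position \<Rightarrow> nat set \<Rightarrow> nat set \<Rightarrow> nat set \<Rightarrow> bool" where
  "covered_pair \<sigma> w L c p U P X \<longleftrightarrow> (\<exists>A B C. U = A \<union> B \<union> C \<and> A \<inter> B = {} \<and> B \<inter> C = {} \<and>
     tile \<sigma> w L c p A P \<and> tile \<sigma> w L c p B P \<and> isolated p B \<and> isolated p (A \<union> C) \<and>
     cover w p A C \<and> colour p ` C = X)"

text \<open>The last argument is a dummy that gives tiles the same type as covered pairs.\<close>

definition isolated_tile ::
    "real \<Rightarrow> nat \<Rightarrow> real \<Rightarrow> nat \<Rightarrow> position \<Rightarrow> nat set \<Rightarrow> nat set \<Rightarrow> nat set \<Rightarrow> bool" where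
  "isolated_tile \<sigma> w L c p U P X \<longleftrightarrow> tile \<sigma> w L c p U P \<and> isolated p U \<and> X = {}"

text \<open>The colour sets \<open>P\<close> and \<open>X\<close> serve as the key on which copies of a gadget are matched.\<close>

definition gadget :: "(position \<Rightarrow> nat set \<Rightarrow> nat set \<Rightarrow> nat set \<Rightarrow> bool) \<Rightarrow> bool" where
  "gadget G \<longleftrightarrow>
     (\<forall>p U P X. G p U P X \<longrightarrow> P \<union> X \<subseteq> colour p ` verts p) \<and>
     (\<forall>p q U P X. G p U P X \<longrightarrow> fresh_extension p q \<longrightarrow> G q U P X)"

lemma gadget_colours: "gadget G \<Longrightarrow> G p U P X \<Longrightarrow> P \<union> X \<subseteq> colour p ` verts p"
  unfolding gadget_def by metis

lemma gadget_fresh: "gadget G \<Longrightarrow> G p U P X \<Longrightarrow> fresh_extension p q \<Longrightarrow> G q U P X"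
  unfolding gadget_def by metis

lemma gadget_isolated_tile: "gadget (isolated_tile \<sigma> w L c)"
proof -
  have "P \<union> X \<subseteq> colour p ` verts p" if "isolated_tile \<sigma> w L c p U P X" for p U P X
    using that by (auto simp: isolated_tile_def tile_def)
  moreover have "isolated_tile \<sigma> w L c q U P X"
    if "isolated_tile \<sigma> w L c p U P X" "fresh_extension p q" for p q U P X
    using that tile_prefix[of \<sigma> w L c p U P q] isolated_fresh[of p U q]
    by (simp add: isolated_tile_def fresh_extension_def tile_def)
  ultimately show ?thesis
    by (simp add: gadget_def)
qed

lemma gadget_covered_pair: "gadget (covered_pair \<sigma> w L c)"
  unfolding gadget_def
proof (intro conjI allI impI)
  fix p U P X assume "covered_pair \<sigma> w L c p U P X"
  then obtain A B C where "U = A \<union> B \<union> C" "tile \<sigma> w L c p A P" "tile \<sigma> w L c p B P"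
     "cover w p A C" "colour p ` C = X"
    by (auto simp: covered_pair_def)
  then show "P \<union> X \<subseteq> colour p ` verts p"
    by (auto simp: tile_def cover_def)
next
  fix p q U P X
  assume "covered_pair \<sigma> w L c p U P X" and f: "fresh_extension p q"
  then obtain A B C where h: "U = A \<union> B \<union> C" "A \<inter> B = {}" "B \<inter> C = {}"
     "tile \<sigma> w L c p A P" "tile \<sigma> w L c p B P" "isolated p B" "isolated p (A \<union> C)"
     "cover w p A C" "colour p ` C = X"
    by (auto simp: covered_pair_def)
  have pq: "prefix p q" using f by (simp add: fresh_extension_def)
  have sub: "A \<subseteq> verts p" "B \<subseteq> verts p" "C \<subseteq> verts p" "A \<union> C \<subseteq> verts p"
    using h by (auto simp: tile_def cover_def)
  show "covered_pair \<sigma> w L c q U P X"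
    unfolding covered_pair_def
    using h(1-3) tile_prefix[OF h(4) pq] tile_prefix[OF h(5) pq] isolated_fresh[OF h(6) sub(2) f]
      isolated_fresh[OF h(7) sub(4) f] cover_prefix[OF h(8) pq sub(1)]
      colour_image_prefix[OF pq sub(3)] h(9)
    by blast
qed

subsection \<open>Forcing gadgets\<close>

locale colouring_game =
  fixes \<sigma> :: real and \<omega> k :: nat
begin

text \<open>The representation is chosen anew at each position: the algorithm never sees intervals,
  so components may be moved later.\<close>

definition legal :: "position \<Rightarrow> bool" where
  "legal p \<longleftrightarrow> cliques_le p (verts p) \<omega> \<and> (\<exists>l r. interval_rep \<sigma> p (verts p) l r)"

definition won :: "position \<Rightarrow> bool" where
  "won p \<longleftrightarrow> legal p \<and> k \<le> card (colour p ` verts p)"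

text \<open>The escape clause \<open>won\<close> bounds the number of colours in play, which makes pigeonholing on
  colour sets possible.\<close>

abbreviation reach :: "(position \<Rightarrow> bool) \<Rightarrow> position \<Rightarrow> bool" where
  "reach Q \<equiv> can_force (\<lambda>q. Q q \<or> won q)"

lemma reach_trans:
  assumes "reach Q p" "\<And>q. Q q \<Longrightarrow> reach R q"
  shows "reach R p"
  using assms by (auto intro: can_force_trans can_force.stop)

lemma reach_stop: "Q p \<Longrightarrow> reach Q p"
  by (rule can_force.stop) simp

lemma reach_block: "N \<subseteq> verts p \<Longrightarrow> reach (block_extension p N m) p"
  by (rule can_force_trans[OF can_force_block]) (auto intro: can_force.stop)

text \<open>\<open>U\<close> may contain old vertices, which are then laid out afresh. The other
  vertices keep their representation, and since \<open>U\<close> is isolated the two layouts can be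
  placed side by side.\<close>

lemma legal_extend:
  assumes p: "legal p" and pq: "prefix p q"
    and U: "U \<subseteq> verts q" "verts q - U \<subseteq> verts p" "isolated q U"
    and new: "cliques_le q U \<omega>" "interval_rep \<sigma> q U l r"
  shows "legal q"
proof -
  let ?W = "verts q - U"
  obtain l' r' where old: "interval_rep \<sigma> p (verts p) l' r'" "cliques_le p (verts p) \<omega>"
    using p by (auto simp: legal_def)
  have W: "interval_rep \<sigma> q ?W l' r'" "cliques_le q ?W \<omega>"
    using interval_rep_subset[OF old(1) U(2)] cliques_le_subset[OF old(2) U(2)]
      interval_rep_prefix[OF pq U(2)] cliques_le_prefix[OF pq U(2)] by simp_all
  have fin: "finite U" "finite ?W"
    using U(1) finite_subset by (auto simp: verts_def)
  have noadj: "\<not> adj q u v" if "u \<in> U" "v \<in> ?W" for u v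
    using that U(3) by (auto simp: isolated_def)
  have verts: "verts q = U \<union> ?W"
    using U(1) by blast
  have "cliques_le q (verts q) \<omega>"
    by (subst verts) (rule cliques_le_separate[OF new(1) W(2) noadj], auto)
  moreover have "\<exists>l r. interval_rep \<sigma> q (verts q) l r"
    by (subst verts) (rule interval_rep_separate[OF new(2) W(1) fin _ noadj], auto)
  ultimately show ?thesis
    by (simp add: legal_def)
qed

text \<open>Demanded from every legal position, so that production can be repeated, and on new
  vertices, so that successive copies are disjoint.\<close>

definition producible :: "(position \<Rightarrow> nat set \<Rightarrow> nat set \<Rightarrow> nat set \<Rightarrow> bool) \<Rightarrow> bool" where
  "producible G \<longleftrightarrow> (\<forall>p. legal p \<longrightarrow>
     reach (\<lambda>q. fresh_extension p q \<and> legal q \<and>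
       (\<exists>U P X. U \<subseteq> {length p..<length q} \<and> G q U P X)) p)"

lemma producibleD:
  "producible G \<Longrightarrow> legal p \<Longrightarrow> reach (\<lambda>q. fresh_extension p q \<and> legal q \<and>
     (\<exists>U P X. U \<subseteq> {length p..<length q} \<and> G q U P X)) p"
  by (simp add: producible_def)

text \<open>Pigeonhole: copies are produced until a key repeats. Fewer than \<open>k\<close> colours
  admit only boundedly many keys, so a long run without repetition means that the game is
  won.\<close>

lemma reach_equal_pair:
  assumes G: "gadget G" "producible G" and p: "legal p"
  shows "reach (\<lambda>q. fresh_extension p q \<and> legal q \<and>
    (\<exists>U V P X. U \<union> V \<subseteq> {length p..<length q} \<and> U \<inter> V = {} \<and> G q U P X \<and> G q V P X)) p"
    (is "reach ?Q p")
proof -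
  \<comment> \<open>\<open>K\<close> holds the distinct keys met so far and \<open>n\<close> bounds
    the productions still to come. A new key trades one unit of \<open>n\<close> for one element of
    \<open>K\<close>, so the sum stays above the number of pairs of subsets of \<open>k\<close>
    colours.\<close>
  have "reach ?Q q"
    if "fresh_extension p q" "legal q" "finite K" "2 ^ k * 2 ^ k < n + card K"
      "\<forall>(P, X)\<in>K. \<exists>U. U \<subseteq> {length p..<length q} \<and> G q U P X" for n q K
    using that
  proof (induction n arbitrary: q K)
    case 0
    \<comment> \<open>more keys than pairs of subsets of \<open>k\<close> colours, so at least \<open>k\<close> colours are in use\<close>
    let ?F = "colour q ` verts q"
    have "P \<union> X \<subseteq> ?F" if "(P, X) \<in> K" for P X
      using 0(5) that gadget_colours[OF G(1)] by blast
    then have "K \<subseteq> Pow ?F \<times> Pow ?F"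
      by (intro subrelI) simp
    then have "card K \<le> card (Pow ?F \<times> Pow ?F)"
      by (intro card_mono) (auto simp: verts_def)
    also have "\<dots> = 2 ^ card ?F * 2 ^ card ?F"
      by (simp add: card_cartesian_product card_Pow verts_def)
    finally have "2 ^ k * 2 ^ k < (2 ^ card ?F * 2 ^ card ?F :: nat)"
      using 0(4) by simp
    then have "k \<le> card ?F"
      by (meson le_cases linorder_not_less mult_le_mono one_le_numeral power_increasing)
    then show ?case
      using 0(2) by (intro can_force.stop) (simp add: won_def)
  next
    case (Suc n)
    have "reach (\<lambda>r. fresh_extension q r \<and> legal r \<and>
       (\<exists>U P X. U \<subseteq> {length q..<length r} \<and> G r U P X)) q"
      by (rule producibleD[OF G(2) Suc.prems(2)])
    then show ?case
    proof (rule reach_trans)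
      fix r assume r: "fresh_extension q r \<and> legal r \<and>
        (\<exists>U P X. U \<subseteq> {length q..<length r} \<and> G r U P X)"
      then obtain V P X where V: "V \<subseteq> {length q..<length r}" "G r V P X"
        by blast
      have pr: "fresh_extension p r"
        using fresh_extension_trans Suc.prems(1) r by blast
      have len: "length p \<le> length q" "length q \<le> length r"
        using Suc.prems(1) r by (auto simp: fresh_extension_def prefix_length_le)
      have keep: "G r U P X" if "G q U P X" for U P X
        using gadget_fresh[OF G(1) that] r by simp
      show "reach ?Q r"
      proof (cases "(P, X) \<in> K")
        case True
        then obtain U where U: "U \<subseteq> {length p..<length q}" "G q U P X"
          using bspec[OF Suc.prems(5) True] by auto
        have "U \<inter> V = {}" "U \<union> V \<subseteq> {length p..<length r}"
          using U(1) V(1) len by fastforce+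
        with pr r keep[OF U(2)] V(2) show ?thesis
          by (intro reach_stop) blast
      next
        case False
        show ?thesis
        proof (rule Suc.IH[OF pr])
          show "legal r" "finite (insert (P, X) K)" using r Suc.prems(3) by simp_all
          show "2 ^ k * 2 ^ k < n + card (insert (P, X) K)"
            using Suc.prems(3,4) False by simp
          have "\<exists>U. U \<subseteq> {length p..<length r} \<and> G r U P' X'" if K: "(P', X') \<in> K" for P' X'
          proof -
            obtain U where "U \<subseteq> {length p..<length q}" "G q U P' X'"
              using bspec[OF Suc.prems(5) K] by auto
            moreover from this(1) have "U \<subseteq> {length p..<length r}"
              using len by fastforce
            ultimately show ?thesis using keep by blast
          qed
          moreover have "V \<subseteq> {length p..<length r}" using V(1) len by auto
          ultimately show "\<forall>(P, X)\<in>insert (P, X) K. \<exists>U. U \<subseteq> {length p..<length r} \<and> G r U P X"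
            using V(2) by auto
        qed
      qed
    qed
  qed
  from this[of p "{}" "2 ^ k * 2 ^ k + 1"] p show ?thesis
    by (simp add: fresh_extension_refl)
qed

text \<open>Of two tiles with equal colours one is covered by a clique, whose neighbours lie in that
  tile and in itself, so the other stays isolated. For legality the covered tile is viewed as a
  chain with a single link.\<close>

lemma producible_covered_pair:
  assumes tile: "producible (isolated_tile \<sigma> w L c)" and L: "0 \<le> L" "L + 2 < \<sigma>" and w: "2 * w \<le> \<omega>"
  shows "producible (covered_pair \<sigma> w L c)"
  unfolding producible_def
proof (intro allI impI)
  fix p assume p: "legal p"
  show "reach (\<lambda>q. fresh_extension p q \<and> legal q \<and>
       (\<exists>U P X. U \<subseteq> {length p..<length q} \<and> covered_pair \<sigma> w L c q U P X)) p" (is "reach ?Q p")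
  proof (rule reach_trans[OF reach_equal_pair[OF gadget_isolated_tile tile p]])
    fix q assume "fresh_extension p q \<and> legal q \<and> (\<exists>A B P X. A \<union> B \<subseteq> {length p..<length q} \<and>
      A \<inter> B = {} \<and> isolated_tile \<sigma> w L c q A P X \<and> isolated_tile \<sigma> w L c q B P X)"
    then obtain A B P where q: "fresh_extension p q" "legal q"
      and AB: "A \<union> B \<subseteq> {length p..<length q}" "A \<inter> B = {}"
      and A: "tile \<sigma> w L c q A P" "isolated q A" and B: "tile \<sigma> w L c q B P" "isolated q B"
      by (auto simp: isolated_tile_def)
    have verts: "A \<subseteq> verts q" "B \<subseteq> verts q"
      using A(1) B(1) by (auto simp: tile_def)
    show "reach ?Q q"
    proof (rule reach_trans[OF reach_block[OF verts(1), of w]], rule reach_stop)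
      fix r assume r: "block_extension q A w r"
      define C where "C = {length q..<length r}"
      have qr: "prefix q r" "length r = length q + w"
        using r by (auto simp: block_extension_def)
      have "length p \<le> length q"
        using q(1) by (simp add: fresh_extension_def prefix_length_le)
      have pr: "fresh_extension p r"
        using AB(1) by (intro fresh_extension_block[OF q(1) r]) (auto simp: verts_def)
      have cov: "cover w r A C"
        unfolding C_def by (rule cover_block[OF r verts(1)])
      have Ar: "tile \<sigma> w L c r A P" and Br: "tile \<sigma> w L c r B P"
        using tile_prefix[OF A(1) qr(1)] tile_prefix[OF B(1) qr(1)] by simp_all
      have AC: "isolated r (A \<union> C)"
        unfolding isolated_def
      proof (intro ballI allI impI)
        fix u v assume u: "u \<in> A \<union> C" and a: "adj r u v"
        show "v \<in> A \<union> C"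
        proof (cases "v < length q")
          case True
          show ?thesis
          proof (cases "u \<in> C")
            case c: True
            then show ?thesis
              using a adj_block_old[OF r True, of u] adj_sym[of r u v] by (simp add: C_def)
          next
            case False
            with u have "u \<in> A" by simp
            moreover from this have "adj q u v"
              using a True verts(1) adj_prefix[OF qr(1), of u v] by (auto simp: verts_def)
            ultimately show ?thesis using A(2) by (auto simp: isolated_def)
          qed
        next
          case False
          then show ?thesis using a by (auto simp: adj_def C_def)
        qed
      qed
      have Bi: "isolated r B"
        unfolding isolated_def
      proof (intro ballI allI impI)
        fix u v assume u: "u \<in> B" and a: "adj r u v"
        have uq: "u < length q" using u verts by (auto simp: verts_def)
        have "v < length q"
        proof (rule ccontr)
          assume "\<not> v < length q"
          then have "v \<in> {length q..<length r}" using a by (auto simp: adj_def)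
          then have "u \<in> A" using adj_block_old[OF r uq] a by blast
          with u AB(2) show False by blast
        qed
        then show "v \<in> B"
          using a u uq adj_prefix[OF qr(1), of u v] B(2) by (auto simp: isolated_def)
      qed
      have "chain \<sigma> w r ({} \<union> A \<union> C) C (0 + L + 2)"
        by (rule chain_link_tile[OF chain_empty _ L Ar cov]) simp_all
      then obtain l r' where "cliques_le r (A \<union> C) (2 * w)" "interval_rep \<sigma> r (A \<union> C) l r'"
        by (auto simp: chain_def)
      moreover have "A \<union> C \<subseteq> verts r" "verts r - (A \<union> C) \<subseteq> verts q"
        using verts(1) qr(2) by (auto simp: verts_def C_def)
      ultimately have "legal r"
        using legal_extend[OF q(2) qr(1) _ _ AC] cliques_le_mono[OF _ w] by blast
      moreover have "A \<union> B \<union> C \<subseteq> {length p..<length r}"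
        using AB(1) qr(2) \<open>length p \<le> length q\<close> by (auto simp: C_def)
      moreover have "B \<inter> C = {}"
        using AB(1) by (auto simp: C_def)
      then have "covered_pair \<sigma> w L c r (A \<union> B \<union> C) P (colour r ` C)"
        unfolding covered_pair_def using AB(2) Ar Br Bi AC cov by blast
      ultimately show "?Q r" using pr by blast
    qed
  qed
qed

end

section \<open>Linking two covered pairs doubles the clique number\<close>

text \<open>The four copies end up in the spatial order \<open>A, B, B', A'\<close>, covered by \<open>C, Y, Z, C'\<close>.\<close>

lemma link_covered_pairs:
  assumes disj: "A \<inter> B = {}" "A \<inter> C = {}" "B \<inter> C = {}" "A' \<inter> B' = {}" "A' \<inter> C' = {}" "B' \<inter> C' = {}"
        "(A \<union> B \<union> C) \<inter> (A' \<union> B' \<union> C') = {}"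
    and A: "tile \<sigma> w L c q A P" and B: "tile \<sigma> w L c q B P" "isolated q B"
    and C: "isolated q (A \<union> C)" "cover w q A C"
    and A': "tile \<sigma> w L c q A' P" and B': "tile \<sigma> w L c q B' P" "isolated q B'"
    and C': "isolated q (A' \<union> C')" "cover w q A' C'"
    and colours: "colour q ` C = X" "colour q ` C' = X"
    and L: "0 \<le> L" "L + 2 < \<sigma>"
    and r: "block_extension q (B \<union> C) w r" and Y: "Y = {length q..<length r}"
    and s: "block_extension r (B' \<union> C' \<union> Y) w s" and Z: "Z = {length r..<length s}"
    and W: "W = A \<union> C \<union> B \<union> Y \<union> B' \<union> Z \<union> A' \<union> C'"
  shows "isolated_tile \<sigma> (2 * w) (4 * L + 8) (c + 3 * w) s W (colour s ` W) {}"
proof -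
  have qr: "prefix q r" "length r = length q + w" and rs: "prefix r s" "length s = length r + w"
    using r s by (auto simp: block_extension_def)
  have qs: "prefix q s"
    using qr rs by (auto intro: prefix_order.trans)
  have sub: "A \<subseteq> verts q" "B \<subseteq> verts q" "C \<subseteq> verts q" "A' \<subseteq> verts q" "B' \<subseteq> verts q" "C' \<subseteq> verts q"
    using A B C A' B' C' by (simp_all add: tile_def cover_def)
  have vr: "verts r = verts q \<union> Y" "verts q \<inter> Y = {}" and vs: "verts s = verts r \<union> Z" "verts r \<inter> Z = {}"
    using qr(2) rs(2) by (auto simp: verts_def Y Z)
  have cross: "A \<inter> A' = {}" "A \<inter> B' = {}" "A \<inter> C' = {}" "B \<inter> A' = {}" "B \<inter> B' = {}" "B \<inter> C' = {}"
      "C \<inter> A' = {}" "C \<inter> B' = {}" "C \<inter> C' = {}"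
    using disj(7) by auto
  have new: "S \<inter> Y = {}" "Y \<inter> S = {}" "S \<inter> Z = {}" "Z \<inter> S = {}" if "S \<subseteq> verts q" for S
    using that vr vs by auto
  note new_disj = new[OF sub(1)] new[OF sub(2)] new[OF sub(3)] new[OF sub(4)] new[OF sub(5)] new[OF sub(6)]
  have YZ: "Y \<inter> Z = {}"
    using vr vs by auto
  note pairwise = disj(1-6) cross new_disj YZ
  have subY: "B' \<union> C' \<union> Y \<subseteq> verts r" "B \<union> C \<subseteq> verts q"
    using sub vr by auto
  have old: "adj s u v \<longleftrightarrow> adj q u v" if "u \<in> verts q" "v \<in> verts q" for u v
    using adj_prefix[OF qs] that by (simp add: verts_def)
  have adjY: "adj s u y \<longleftrightarrow> u \<in> B \<union> C" if "u \<in> verts q" "y \<in> Y" for u y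
  proof -
    have "adj s u y \<longleftrightarrow> adj r u y"
      using adj_prefix[OF rs(1), of u y] that vr by (auto simp: verts_def)
    then show ?thesis
      using adj_block_old[OF r, of u y] that by (simp add: verts_def Y)
  qed
  have adjZ: "adj s u z \<longleftrightarrow> u \<in> B' \<union> C' \<union> Y" if "u \<in> verts r" "z \<in> Z" for u z
    using adj_block_old[OF s, of u z] that by (simp add: verts_def Z)
  have coverY: "cover w s B Y"
    using cover_prefix[OF cover_mono[OF cover_block[OF r subY(2)]] rs(1)] sub(2) vr(1) Y by auto
  have coverZ: "cover w s B' Z"
    using cover_mono[OF cover_block[OF s subY(1)]] Z by auto
  note tiles = A[THEN tile_prefix[OF _ qs]] B(1)[THEN tile_prefix[OF _ qs]]
    A'[THEN tile_prefix[OF _ qs]] B'(1)[THEN tile_prefix[OF _ qs]]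
  note covers = cover_prefix[OF C(2) qs sub(1)] cover_prefix[OF C'(2) qs sub(4)]

  \<comment> \<open>The links follow the order on the line, not the order of presentation:
    \<open>C'\<close> is older than \<open>Y\<close> and \<open>Z\<close>, yet it closes the
    chain.\<close>
  have link1: "chain \<sigma> w s ({} \<union> A \<union> C) C (0 + L + 2)"
    by (rule chain_link_tile[OF chain_empty _ L tiles(1) covers(1)]) simp_all
  have link2: "chain \<sigma> w s ({} \<union> A \<union> C \<union> B \<union> Y) Y (0 + L + 2 + L + 2)"
  proof (rule chain_link_tile[OF link1 _ L tiles(2) coverY])
    show "({} \<union> A \<union> C) \<inter> B = {}" using disj by blast
    show "({} \<union> A \<union> C) \<inter> Y = {}" by (simp add: Int_Un_distrib2 pairwise)
    fix u assume u: "u \<in> {} \<union> A \<union> C"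
    then have uq: "u \<in> verts q" and "u \<notin> B" using sub disj by auto
    show "\<not> adj s u t" if "t \<in> B" for t
    proof -
      have "t \<notin> A \<union> C" using that disj by blast
      then show ?thesis
        using isolatedD[OF C(1)] u old[OF uq] that sub(2) by auto
    qed
    show "adj s u y \<longleftrightarrow> u \<in> C" if "y \<in> Y" for y
      using adjY[OF uq that] \<open>u \<notin> B\<close> by simp
  qed (use L in simp)
  have link3: "chain \<sigma> w s ({} \<union> A \<union> C \<union> B \<union> Y \<union> B' \<union> Z) Z (0 + L + 2 + L + 2 + L + 2)"
  proof (rule chain_link_tile[OF link2 _ L tiles(4) coverZ])
    show "({} \<union> A \<union> C \<union> B \<union> Y) \<inter> B' = {}" by (simp add: Int_Un_distrib2 pairwise)
    show "({} \<union> A \<union> C \<union> B \<union> Y) \<inter> Z = {}" by (simp add: Int_Un_distrib2 pairwise)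
    fix u assume u: "u \<in> {} \<union> A \<union> C \<union> B \<union> Y"
    then have ur: "u \<in> verts r" and uB: "u \<notin> B'" "u \<notin> C'" using sub pairwise vr(1) by auto
    show "\<not> adj s u t" if t: "t \<in> B'" for t
    proof (cases "u \<in> Y")
      case True
      have "t \<notin> B \<union> C" using t cross by blast
      then show ?thesis
        using adjY[of t u] True t sub(5) adj_sym[of s u t] by auto
    next
      case False
      then have "u \<in> verts q" using ur vr(1) by simp
      then show ?thesis
        using isolatedD[OF B'(2) t uB(1)] old[of t u] t sub(5) adj_sym[of s u t] by auto
    qed
    show "adj s u z \<longleftrightarrow> u \<in> Y" if "z \<in> Z" for z
      using adjZ[OF ur that] uB by simp
  qed (use L in simp)
  \<comment> \<open>The edges between \<open>Z\<close> and \<open>C'\<close> stem from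
    \<open>Z\<close>, which was presented last and joined to all of \<open>C'\<close>.\<close>
  have link4: "chain \<sigma> w s ({} \<union> A \<union> C \<union> B \<union> Y \<union> B' \<union> Z \<union> A' \<union> C') C'
      (0 + L + 2 + L + 2 + L + 2 + L + 2)"
  proof (rule chain_link_tile[OF link3 _ L tiles(3) covers(2)])
    show "({} \<union> A \<union> C \<union> B \<union> Y \<union> B' \<union> Z) \<inter> A' = {}" by (simp add: Int_Un_distrib2 pairwise Int_commute[of B' A'])
    show "({} \<union> A \<union> C \<union> B \<union> Y \<union> B' \<union> Z) \<inter> C' = {}" by (simp add: Int_Un_distrib2 pairwise)
    fix u assume u: "u \<in> {} \<union> A \<union> C \<union> B \<union> Y \<union> B' \<union> Z"
    have other: "\<not> adj s u v" if v: "v \<in> A' \<union> C'" and "u \<notin> Z" for v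
    proof -
      have vq: "v \<in> verts q" and vBC: "v \<notin> B \<union> C" using v sub cross by auto
      show ?thesis
      proof (cases "u \<in> Y")
        case True
        then show ?thesis using adjY[OF vq True] vBC adj_sym[of s u v] by simp
      next
        case False
        then have uq: "u \<in> verts q" using u \<open>u \<notin> Z\<close> sub by blast
        have "u \<notin> A' \<union> C'" using u \<open>u \<notin> Z\<close> False cross disj(4,6) by blast
        then show ?thesis
          using isolatedD[OF C'(1) v] old[OF vq uq] adj_sym[of s u v] by simp
      qed
    qed
    show "\<not> adj s u t" if t: "t \<in> A'" for t
    proof (cases "u \<in> Z")
      case True
      have "t \<in> verts q" "t \<notin> B' \<union> C'" using t sub(4) disj(4,5) by auto
      then have "t \<in> verts r" "t \<notin> B' \<union> C' \<union> Y" using vr by (simp_all add: disjoint_iff)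
      then show ?thesis using adjZ[OF _ True] adj_sym[of s u t] by simp
    qed (use other t in simp)
    show "adj s u d \<longleftrightarrow> u \<in> Z" if d: "d \<in> C'" for d
    proof (cases "u \<in> Z")
      case True
      have "d \<in> verts r" using d sub(6) vr(1) by auto
      then show ?thesis using adjZ[OF _ True] adj_sym[of s u d] d True by simp
    qed (use other d in simp)
  qed (use L in simp)
  \<comment> \<open>Four tiles, each lengthening the chain by \<open>L + 2\<close>.\<close>
  have chain: "chain \<sigma> w s W C' (4 * L + 8)"
    using link4 by (simp add: W algebra_simps)

  have W_verts: "W \<subseteq> verts s"
    using sub unfolding W vr(1) vs(1) by blast
  have isolated: "isolated s W"
    unfolding isolated_def
  proof (intro ballI allI impI)
    fix u v assume u: "u \<in> W" and a: "adj s u v"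
    have "v \<in> verts s" using a by (auto simp: adj_def verts_def)
    then consider "v \<in> Y" | "v \<in> Z" | "v \<in> verts q" unfolding vs(1) vr(1) by blast
    then show "v \<in> W"
    proof cases
      case vq: 3
      have a': "adj s v u" using a adj_sym[of s u v] by simp
      have "u \<in> verts s" using W_verts u by blast
      then consider "u \<in> Y" | "u \<in> Z" | "u \<in> verts q" unfolding vs(1) vr(1) by blast
      then show ?thesis
      proof cases
        case 1
        then show ?thesis using adjY[OF vq 1] a' by (auto simp: W)
      next
        case 2
        then show ?thesis using adjZ[OF _ 2, of v] a' vq vr(1) by (auto simp: W)
      next
        case 3
        then have aq: "adj q u v" using old vq a by blast
        have "u \<in> A \<union> C \<or> u \<in> B \<or> u \<in> A' \<union> C' \<or> u \<in> B'"
          using u 3 new[OF order_refl] unfolding W by blast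
        then show ?thesis
          using isolatedD[OF C(1), of u v] isolatedD[OF B(2), of u v] isolatedD[OF C'(1), of u v]
            isolatedD[OF B'(2), of u v] aq unfolding W by blast
      qed
    qed (auto simp: W)
  qed

  let ?Y = "colour s ` Y" and ?Z = "colour s ` Z"
  have old_colours: "colour s ` A = P" "colour s ` B = P" "colour s ` A' = P" "colour s ` B' = P"
    "colour s ` C = X" "colour s ` C' = X"
    using tiles colours colour_image_prefix[OF qs sub(3)] colour_image_prefix[OF qs sub(6)]
    by (simp_all add: tile_def)
  have W_colours: "colour s ` W = P \<union> X \<union> ?Y \<union> ?Z"
    by (auto simp: W image_Un old_colours)
  have fin: "finite P" "finite X" "finite ?Y" "finite ?Z"
    using finite_subset[OF sub(1)] finite_subset[OF sub(3)] old_colours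
    by (auto simp: Y Z verts_def)
  \<comment> \<open>The equal colour sets pay off here: \<open>Y\<close> sees \<open>P\<close> and
    \<open>X\<close> through \<open>B\<close> and \<open>C\<close>, while \<open>Z\<close> sees the
    same \<open>P\<close> and \<open>X\<close> through \<open>B'\<close> and \<open>C'\<close>, and
    \<open>Y\<close> besides. Hence the colours of \<open>Y\<close> and \<open>Z\<close> are new
    each time.\<close>
  have "cover w s (B \<union> C) Y" "cover w s (B' \<union> C' \<union> Y) Z"
    using cover_prefix[OF cover_block[OF r subY(2)] rs(1)] cover_block[OF s subY(1)] vr(1) subY(2) Y Z
    by auto
  then have "(P \<union> X) \<inter> ?Y = {}" "(P \<union> X \<union> ?Y) \<inter> ?Z = {}" "card ?Y = w" "card ?Z = w"
    unfolding cover_def image_Un old_colours by auto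
  moreover have "P \<inter> X = {}" "card X = w"
    using covers(1) unfolding cover_def old_colours by auto
  moreover have "c \<le> card P"
    using A by (simp add: tile_def)
  ultimately have "c + 3 * w \<le> card (P \<union> X \<union> ?Y \<union> ?Z)"
    using fin by (simp add: card_Un_disjoint)
  then have "tile \<sigma> (2 * w) (4 * L + 8) (c + 3 * w) s W (colour s ` W)"
    using chain W_verts W_colours unfolding tile_def chain_def by force
  with isolated show ?thesis
    by (simp add: isolated_tile_def)
qed

context colouring_game
begin

text \<open>Two blocks complete an equal pair of covered pairs to a chain. Legality holds because
  both pairs and the blocks form one isolated set \<open>W\<close>, laid out afresh, and everything
  outside \<open>W\<close> is old.\<close>

lemma producible_double:
  assumes tile: "producible (isolated_tile \<sigma> w L c)" and L: "0 \<le> L" "L + 2 < \<sigma>" and w: "2 * w \<le> \<omega>"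
  shows "producible (isolated_tile \<sigma> (2 * w) (4 * L + 8) (c + 3 * w))"
  unfolding producible_def
proof (intro allI impI)
  fix p assume p: "legal p"
  show "reach (\<lambda>q. fresh_extension p q \<and> legal q \<and> (\<exists>U P X. U \<subseteq> {length p..<length q} \<and>
      isolated_tile \<sigma> (2 * w) (4 * L + 8) (c + 3 * w) q U P X)) p" (is "reach ?Q p")
  proof (rule reach_trans[OF reach_equal_pair[OF gadget_covered_pair producible_covered_pair[OF assms] p]])
    fix q assume "fresh_extension p q \<and> legal q \<and> (\<exists>U V P X. U \<union> V \<subseteq> {length p..<length q} \<and>
      U \<inter> V = {} \<and> covered_pair \<sigma> w L c q U P X \<and> covered_pair \<sigma> w L c q V P X)"
    then obtain U V P X where q: "fresh_extension p q" "legal q"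
      and UV: "U \<union> V \<subseteq> {length p..<length q}" "U \<inter> V = {}"
      and pairs: "covered_pair \<sigma> w L c q U P X" "covered_pair \<sigma> w L c q V P X"
      by blast
    obtain A B C where U: "U = A \<union> B \<union> C" "A \<inter> B = {}" "B \<inter> C = {}"
      and A: "tile \<sigma> w L c q A P" and B: "tile \<sigma> w L c q B P" "isolated q B"
      and AC: "isolated q (A \<union> C)" "cover w q A C" "colour q ` C = X"
      using pairs(1) unfolding covered_pair_def by blast
    obtain A' B' C' where V: "V = A' \<union> B' \<union> C'" "A' \<inter> B' = {}" "B' \<inter> C' = {}"
      and A': "tile \<sigma> w L c q A' P" and B': "tile \<sigma> w L c q B' P" "isolated q B'"
      and AC': "isolated q (A' \<union> C')" "cover w q A' C'" "colour q ` C' = X"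
      using pairs(2) unfolding covered_pair_def by blast
    have "A \<inter> C = {}" "A' \<inter> C' = {}"
      using AC(2) AC'(2) by (simp_all add: cover_def)
    note disj = U(2) \<open>A \<inter> C = {}\<close> U(3) V(2) \<open>A' \<inter> C' = {}\<close> V(3) UV(2)[unfolded U(1) V(1)]
    have sub: "A \<subseteq> verts q" "B \<subseteq> verts q" "C \<subseteq> verts q" "A' \<subseteq> verts q" "B' \<subseteq> verts q" "C' \<subseteq> verts q"
      using A B AC A' B' AC' by (simp_all add: tile_def cover_def)
    show "reach ?Q q"
    proof (rule reach_trans[OF reach_block[of "B \<union> C" _ w]])
      show "B \<union> C \<subseteq> verts q" using sub by simp
      fix r assume r: "block_extension q (B \<union> C) w r"
      define Y where "Y = {length q..<length r}"
      have qr: "prefix q r" "length r = length q + w"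
        using r by (auto simp: block_extension_def)
      have N: "B' \<union> C' \<union> Y \<subseteq> verts r"
        using sub(5,6) qr(2) by (auto simp: Y_def verts_def)
      have "?Q s" if s: "block_extension r (B' \<union> C' \<union> Y) w s" for s
      proof -
        define Z where "Z = {length r..<length s}"
        define W where "W = A \<union> C \<union> B \<union> Y \<union> B' \<union> Z \<union> A' \<union> C'"
        have rs: "prefix r s" "length s = length r + w"
          using s by (auto simp: block_extension_def)
        have qs: "prefix q s"
          using qr(1) rs(1) by (rule prefix_order.trans)
        have tileW: "isolated_tile \<sigma> (2 * w) (4 * L + 8) (c + 3 * w) s W (colour s ` W) {}"
          by (rule link_covered_pairs[OF disj A B AC(1,2) A' B' AC'(1,2) AC(3) AC'(3) L r Y_def s Z_def W_def])
        then obtain l r' where rep: "interval_rep \<sigma> s W l r'"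
          by (auto simp: isolated_tile_def tile_def)
        have "verts s - W \<subseteq> verts q"
          using qr(2) rs(2) by (auto simp: verts_def W_def Y_def Z_def)
        then have "legal s"
          using tileW rep legal_extend[OF q(2) qs _ _ _ cliques_le_mono[OF _ w] rep]
          by (simp add: isolated_tile_def tile_def)
        have pq: "length p \<le> length q"
          using q(1) by (simp add: fresh_extension_def prefix_length_le)
        have fresh: "(B \<union> C) \<inter> verts p = {}" "(B' \<union> C' \<union> Y) \<inter> verts p = {}"
          using UV(1) pq unfolding U(1) V(1) by (auto simp: verts_def Y_def)
        have ps: "fresh_extension p s"
          using fresh_extension_block[OF fresh_extension_block[OF q(1) r fresh(1)] s fresh(2)] .
        have "W \<subseteq> {length p..<length s}"
          using UV(1) pq qr(2) rs(2) unfolding U(1) V(1) by (auto simp: W_def Y_def Z_def)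
        with \<open>legal s\<close> ps tileW show ?thesis by blast
      qed
      then show "reach ?Q r"
        by (intro reach_trans[OF reach_block[OF N, of w]] reach_stop)
    qed
  qed
qed

section \<open>Iterating the doubling from a single clique\<close>

lemma producible_clique:
  assumes "1 < \<sigma>" "w \<le> \<omega>"
  shows "producible (isolated_tile \<sigma> w 1 w)"
  unfolding producible_def
proof (intro allI impI)
  fix p assume p: "legal p"
  show "reach (\<lambda>q. fresh_extension p q \<and> legal q \<and>
       (\<exists>U P X. U \<subseteq> {length p..<length q} \<and> isolated_tile \<sigma> w 1 w q U P X)) p" (is "reach ?Q p")
  proof (rule reach_trans[OF reach_block[of "{}" _ w]], simp, rule reach_stop)
    fix q assume q: "block_extension p {} w q"
    define U where "U = {length p..<length q}"
    have pq: "prefix p q" "length q = length p + w"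
      using q by (auto simp: block_extension_def)
    have fresh: "fresh_extension p q"
      using fresh_extension_block[OF fresh_extension_refl q] by simp
    have iso: "isolated q U"
      unfolding isolated_def
    proof (intro ballI allI impI)
      fix u v assume "u \<in> U" "adj q u v"
      then show "v \<in> U"
        using adj_block_old[OF q, of v u] adj_sym[of q u v] by (cases "v < length p") (auto simp: U_def adj_def)
    qed
    have rep: "interval_rep \<sigma> q U (\<lambda>_. 0) (\<lambda>_. 1)"
      using assms(1) adj_block_new[OF q] by (auto simp: interval_rep_def U_def)
    have cliques: "cliques_le q U w"
      using pq(2) by (intro cliques_le_card) (auto simp: U_def)
    have U: "U \<subseteq> verts q" "verts q - U \<subseteq> verts p"
      by (auto simp: U_def verts_def)
    have "card (colour q ` U) = w"
      using q by (auto simp: block_extension_def U_def card_image)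
    moreover have "\<exists>l r. interval_rep \<sigma> q U l r \<and> (\<forall>u\<in>U. 0 \<le> l u \<and> r u \<le> 1)"
      using rep by fastforce
    ultimately have "isolated_tile \<sigma> w 1 w q U (colour q ` U) {}"
      using iso cliques U(1) by (simp add: isolated_tile_def tile_def)
    then show "?Q q"
      using fresh legal_extend[OF p pq(1) U iso cliques_le_mono[OF cliques assms(2)] rep]
      unfolding U_def by blast
  qed
qed

text \<open>The span iterates \<open>4 * L + 8\<close> from \<open>1\<close>, and the colour count
  grows from \<open>w\<close> by \<open>3 * 2 ^ t * w\<close> per round. Only interval lengths, not
  spans, must stay below \<open>\<sigma>\<close>: leaving level \<open>t\<close> takes length
  \<open>L + 2 = (11 * 4 ^ t - 2) / 3\<close>, which is less than \<open>4 ^ Suc t\<close>.\<close>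

lemma producible_levels:
  assumes "4 ^ t < \<sigma>" "2 ^ t * w \<le> \<omega>"
  shows "producible (isolated_tile \<sigma> (2 ^ t * w) ((11 * 4 ^ t - 8) / 3) ((3 * 2 ^ t - 2) * w))"
  using assms
proof (induction t)
  case 0
  then show ?case using producible_clique[of w] by simp
next
  case (Suc t)
  let ?L = "(11 * 4 ^ t - 8) / 3 :: real"
  have pow: "1 \<le> (4::real) ^ t" by simp
  have \<sigma>: "4 * 4 ^ t < \<sigma>" using Suc.prems(1) by simp
  have "producible (isolated_tile \<sigma> (2 * (2 ^ t * w)) (4 * ?L + 8) ((3 * 2 ^ t - 2) * w + 3 * (2 ^ t * w)))"
  proof (rule producible_double)
    show "producible (isolated_tile \<sigma> (2 ^ t * w) ?L ((3 * 2 ^ t - 2) * w))"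
    proof (rule Suc.IH)
      show "4 ^ t < \<sigma>" using \<sigma> pow by linarith
      show "2 ^ t * w \<le> \<omega>" using Suc.prems(2) by simp
    qed
    show "0 \<le> ?L" using pow by (simp add: field_simps del: one_le_power)
    show "?L + 2 < \<sigma>" using \<sigma> pow by (simp add: field_simps del: one_le_power)
    show "2 * (2 ^ t * w) \<le> \<omega>" using Suc.prems(2) by (simp add: mult.assoc)
  qed
  moreover have "4 * ?L + 8 = (11 * 4 ^ Suc t - 8) / 3"
    by (simp add: field_simps)
  moreover have "(3 * 2 ^ t - 2) * w + 3 * (2 ^ t * w) = (3 * 2 ^ Suc t - 2) * w"
  proof -
    \<comment> \<open>Ensures that the subtraction on naturals is not truncated.\<close>
    have "(2::nat) \<le> 3 * 2 ^ t"
      using one_le_power[of "2::nat" t] by linarith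
    then have "3 * 2 ^ Suc t - 2 = (3 * 2 ^ t - 2) + 3 * (2::nat) ^ t"
      by simp
    then show ?thesis by (simp add: algebra_simps)
  qed
  ultimately show ?case by (simp only: power_Suc mult.assoc)
qed

lemma legal_Nil: "legal []"
  by (simp add: legal_def verts_def cliques_le_card interval_rep_def)

text \<open>With \<open>k\<close> equal to the colour count of the tile, producing the tile wins
  just as the escape clause does.\<close>

lemma reach_won:
  assumes "producible (isolated_tile \<sigma> w L k)"
  shows "can_force won []"
proof -
  have "won q" if "legal q" "isolated_tile \<sigma> w L k q U P X" for q U P X
  proof -
    have "card P \<le> card (colour q ` verts q)"
      using that(2) by (intro card_mono) (auto simp: isolated_tile_def tile_def verts_def)
    then show ?thesis
      using that by (auto simp: won_def isolated_tile_def tile_def)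
  qed
  then show ?thesis
    by (intro can_force_trans[OF producibleD[OF assms legal_Nil]] can_force.stop) blast
qed

lemma forces_colours_if_can_force:
  assumes "can_force won []" "x \<le> real k"
  shows "\<exists>S. online_strategy S \<and> forces_colours S \<sigma> \<omega> x"
proof -
  obtain S where S: "online_strategy S" "\<And>A. online_colouring_algorithm A \<Longrightarrow>
      \<exists>n. won (play S A n) \<and> S (play S A n) = None"
    using can_force_strategy[OF assms(1)] unfolding play_from_Nil by blast
  have "sigma_interval_graph \<sigma> (verts p) (adj p) \<and> clique_number (verts p) (adj p) \<le> \<omega> \<and>
      x \<le> real (card (colour p ` verts p))" if "won p" for p
    using that assms(2) sigma_interval_graphI[of "verts p" \<sigma> p] clique_number_le[of "verts p" p \<omega>]
    by (auto simp: won_def legal_def verts_def)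
  with S show ?thesis
    unfolding forces_colours_def Let_def by metis
qed

end

section \<open>Choosing the number of rounds and absorbing the rounding\<close>

lemma forces_colours_levels:
  assumes "4 ^ t < \<sigma>" "2 ^ t * w \<le> \<omega>" "x \<le> real ((3 * 2 ^ t - 2) * w)"
  shows "\<exists>S. online_strategy S \<and> forces_colours S \<sigma> \<omega> x"
  using colouring_game.forces_colours_if_can_force[OF colouring_game.reach_won
      [OF colouring_game.producible_levels[OF assms(1,2)]] assms(3)] .

theorem theorem11:
  fixes \<epsilon> \<sigma> :: real
  assumes "\<epsilon> > 0" and "\<sigma> \<ge> 1" and "\<sigma> > 18 / \<epsilon>\<^sup>2"
  shows "\<exists>g :: nat \<Rightarrow> real. g \<in> o(\<lambda>_. 1) \<and>
           (\<forall>\<omega>::nat. \<omega> \<ge> 1 \<longrightarrow>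
              (\<exists>S. online_strategy S \<and>
                   forces_colours S \<sigma> \<omega> ((3 - \<epsilon>) * real \<omega> - g \<omega>)))"
proof (cases "\<epsilon> < 3")
  case False
  \<comment> \<open>For \<open>3 \<le> \<epsilon>\<close> the target is not positive, so presenting
    nothing suffices.\<close>
  have "colouring_game.won \<sigma> \<omega> 0 []" for \<omega>
    by (simp add: colouring_game.won_def colouring_game.legal_Nil)
  then have "\<exists>S. online_strategy S \<and> forces_colours S \<sigma> \<omega> ((3 - \<epsilon>) * real \<omega> - 0)" for \<omega>
    using False by (intro colouring_game.forces_colours_if_can_force[of _ _ 0] can_force.stop)
      (auto simp: mult_nonpos_nonneg)
  then show ?thesis
    by (intro exI[of _ "\<lambda>_. 0"]) simp
next
  case True
  have ex: "\<exists>t. 2 / 2 ^ t < \<epsilon>"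
  proof -
    obtain t where "2 / \<epsilon> < 2 ^ t"
      using real_arch_pow[of 2 "2 / \<epsilon>"] by auto
    then show ?thesis using assms(1) by (intro exI[of _ t]) (simp add: field_simps)
  qed
  define t where "t = (LEAST t. 2 / 2 ^ t < \<epsilon>)"
  have t: "2 / 2 ^ t < \<epsilon>"
    unfolding t_def by (rule LeastI_ex[OF ex])
  have least: "\<epsilon> \<le> 2 / 2 ^ s" if "s < t" for s
    using not_less_Least[OF that[unfolded t_def]] by simp
  have \<sigma>: "4 ^ t < \<sigma>"
  proof (cases t)
    case 0
    \<comment> \<open>Minimality of \<open>t\<close> says nothing here; instead
      \<open>\<epsilon> < 3\<close> gives \<open>18 / \<epsilon>\<^sup>2 \<ge> 2\<close>, which
      exceeds \<open>4 ^ 0\<close>.\<close>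
    have "\<epsilon>\<^sup>2 \<le> 3\<^sup>2" using True assms(1) by (intro power_mono) auto
    then have "2 \<le> 18 / \<epsilon>\<^sup>2" using assms(1) by (simp add: field_simps)
    with 0 assms(3) show ?thesis by simp
  next
    case (Suc s)
    \<comment> \<open>Minimality applied to the predecessor \<open>s\<close> gives
      \<open>\<epsilon> \<le> 2 / 2 ^ s = 4 / 2 ^ t\<close>; squaring yields
      \<open>16 / \<epsilon>\<^sup>2\<close>.\<close>
    have "2 ^ t \<le> 4 / \<epsilon>"
      using least[of s] Suc assms(1) by (simp add: field_simps)
    then have "(2 ^ t)\<^sup>2 \<le> (4 / \<epsilon>)\<^sup>2"
      by (intro power_mono) auto
    also have "(2 ^ t)\<^sup>2 = (4 :: real) ^ t"
      by (simp add: power2_eq_square flip: power_mult_distrib)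
    also have "(4 / \<epsilon>)\<^sup>2 \<le> 18 / \<epsilon>\<^sup>2"
      by (simp add: power_divide divide_right_mono)
    finally show ?thesis using assms(3) by simp
  qed
  define c where "c \<omega> = real ((3 * 2 ^ t - 2) * (\<omega> div 2 ^ t))" for \<omega> :: nat
  \<comment> \<open>The shortfall against the target, cut off at \<open>0\<close>: for small
    \<open>\<omega>\<close> it lowers the promise to \<open>c \<omega>\<close>, and for large
    \<open>\<omega>\<close> it vanishes.\<close>
  define g where "g \<omega> = max 0 ((3 - \<epsilon>) * real \<omega> - c \<omega>)" for \<omega> :: nat
  have two: "(2::nat) \<le> 3 * 2 ^ t"
    using one_le_power[of "2::nat" t] by linarith
  \<comment> \<open>Rounding \<open>\<omega> / 2 ^ t\<close> down loses fewer than
    \<open>3 * 2 ^ t\<close> colours, while the ratio \<open>3 - 2 / 2 ^ t\<close> beats the target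
    by \<open>(\<epsilon> - 2 / 2 ^ t) * \<omega>\<close>. The threshold is where this surplus
    covers the loss.\<close>
  have zero: "g \<omega> = 0" if large: "3 * 2 ^ t / (\<epsilon> - 2 / 2 ^ t) \<le> real \<omega>" for \<omega>
  proof -
    have "real \<omega> / 2 ^ t - 1 \<le> real (\<omega> div 2 ^ t)"
    proof -
      have "\<omega> mod 2 ^ t < 2 ^ t" by (rule mod_less_divisor) simp
      then have "\<omega> \<le> \<omega> div 2 ^ t * 2 ^ t + 2 ^ t"
        using div_mult_mod_eq[of \<omega> "2 ^ t"] by linarith
      then have "real \<omega> \<le> real (\<omega> div 2 ^ t * 2 ^ t + 2 ^ t)" by (simp only: of_nat_le_iff)
      then show ?thesis by (simp add: field_simps)
    qed
    then have "(3 * 2 ^ t - 2) * (real \<omega> / 2 ^ t - 1) \<le> (3 * 2 ^ t - 2) * real (\<omega> div 2 ^ t)"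
      by (intro mult_left_mono) (use one_le_power[of "2::real" t] in linarith)+
    also have "\<dots> = c \<omega>"
      using two by (simp add: c_def of_nat_diff)
    finally have "(3 - 2 / 2 ^ t) * real \<omega> - 3 * 2 ^ t + 2 \<le> c \<omega>"
      by (simp add: field_simps)
    moreover have "3 * 2 ^ t \<le> (\<epsilon> - 2 / 2 ^ t) * real \<omega>"
      using large t by (simp add: pos_divide_le_eq mult.commute)
    ultimately show ?thesis
      by (simp add: g_def algebra_simps)
  qed
  have "eventually (\<lambda>\<omega>. g \<omega> = 0) sequentially"
  proof (rule eventually_mono[OF _ zero])
    show "eventually (\<lambda>\<omega>. 3 * 2 ^ t / (\<epsilon> - 2 / 2 ^ t) \<le> real \<omega>) sequentially"
      using filterlim_real_sequentially by (simp add: filterlim_at_top)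
  qed
  then have "g \<in> o(\<lambda>_. 1)"
    by (subst landau_o.small.in_cong[where g = "\<lambda>_. 0"]) auto
  moreover have "\<exists>S. online_strategy S \<and> forces_colours S \<sigma> \<omega> ((3 - \<epsilon>) * real \<omega> - g \<omega>)" for \<omega>
    by (rule forces_colours_levels[OF \<sigma>, of "\<omega> div 2 ^ t"]) (auto simp: g_def c_def)
  ultimately show ?thesis by blast
qed

end
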